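(* Let $\varepsilon,\tau_1,\tau_2>0$, let $\mathcal{H}_1$ and $\mathcal{H}_2$ be finite-dimensional Hilbert spaces, let $C$ be a Hermitian operator on $\mathcal{H}_1\otimes\mathcal{H}_2$, and let $\rho\in\mathrm{H}_{\geq}(\mathcal{H}_1)$, $\sigma\in\mathrm{H}_{\geq}(\mathcal{H}_2)$ be Hermitian positive semi-definite operators. Then there exists a minimizer of the problem $$\inf\left\{\mathrm{Tr}[C\Gamma]+\varepsilon\mathcal{S}[\Gamma]+\tau_1\mathcal{E}[\Gamma_1|\rho]+\tau_2\mathcal{E}[\Gamma_2|\sigma]\ :\ \Gamma\in\mathrm{H}_{\geq}(\mathcal{H}_1\otimes\mathcal{H}_2)\right\}.$$
   Context: $\mathrm{H}_{\geq}(\mathcal{H})$ is the set of Hermitian positive semi-definite operators on $\mathcal{H}$. For $\Gamma\in\mathrm{H}_{\geq}(\mathcal{H}_1\otimes\mathcal{H}_2)$, the partial traces are $\Gamma_1=\mathrm{Tr}_2[\Gamma]$ (on $\mathcal{H}_1$) and $\Gamma_2=\mathrm{Tr}_1[\Gamma]$ (on $\mathcal{H}_2$). The von Neumann entropy is $\mathcal{S}[\Gamma]=\mathrm{Tr}[\Gamma(\log\Gamma-\mathrm{Id})]$. The Umegaki relative entropy of $\gamma_1,\gamma_2\in\mathrm{H}_{\geq}(\mathcal{H})$ is $$\mathcal{E}[\gamma_1|\gamma_2]=\mathrm{Tr}[\gamma_1(\log\gamma_1-\log\gamma_2-\mathrm{Id})+\gamma_2]\ \text{ if }\ker\gamma_2\subset\ker\gamma_1,\qquad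 \mathcal{E}[\gamma_1|\gamma_2]=+\infty\ \text{ otherwise},$$ with the convention $0\log 0=0$ ($\mathrm{Tr}[\gamma_1\log\gamma_2]$ being computed on the range of $\gamma_2$). The objective takes values in $\mathbb{R}\cup\{+\infty\}$. *)

theory Defs
  imports "HOL-Analysis.Analysis"
begin

text \<open>
  A finite-dimensional complex Hilbert space with a chosen orthonormal basis indexed by the
  finite type \<open>'n\<close> is \<open>complex^'n\<close>, and its operators are matrices \<open>complex^'n^'n\<close>.
  The tensor product of \<open>complex^'m\<close> and \<open>complex^'n\<close> is \<open>complex^('m \<times> 'n)\<close>, the
  index \<open>(i, k)\<close> standing for the product basis vector of \<open>i\<close> and \<open>k\<close>.
\<close>

definition cadjoint :: "complex^'n^'n \<Rightarrow> complex^'n^'n" where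
  "cadjoint A = (\<chi> i j. cnj (A $ j $ i))"

definition hermitian :: "complex^'n^'n \<Rightarrow> bool" where
  "hermitian A \<longleftrightarrow> cadjoint A = A"

text \<open>The library inner product on \<open>complex^'n\<close> is the real one; this is the complex one.\<close>

definition cinner_vec :: "complex^'n \<Rightarrow> complex^'n \<Rightarrow> complex" where
  "cinner_vec v w = (\<Sum>i\<in>UNIV. cnj (v $ i) * w $ i)"

definition herm_psd :: "(complex^'n^'n) set" where
  "herm_psd = {A. hermitian A \<and> (\<forall>v. 0 \<le> Re (cinner_vec v (A *v v)))}"

definition mat_kernel :: "complex^'n^'n \<Rightarrow> (complex^'n) set" where
  "mat_kernel A = {v. A *v v = 0}"

definition ptrace_snd :: "complex^('m::finite \<times> 'n::finite)^('m \<times> 'n) \<Rightarrow> complex^'m^'m" where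
  "ptrace_snd G = (\<chi> i j. \<Sum>k\<in>UNIV. G $ (i, k) $ (j, k))"

definition ptrace_fst :: "complex^('m::finite \<times> 'n::finite)^('m \<times> 'n) \<Rightarrow> complex^'n^'n" where
  "ptrace_fst G = (\<chi> k l. \<Sum>i\<in>UNIV. G $ (i, k) $ (i, l))"

definition eigenspace :: "complex^'n^'n \<Rightarrow> real \<Rightarrow> (complex^'n) set" where
  "eigenspace A \<mu> = {v. A *v v = complex_of_real \<mu> *s v}"

definition real_spectrum :: "complex^'n^'n \<Rightarrow> real set" where
  "real_spectrum A = {\<mu>. \<exists>v\<in>eigenspace A \<mu>. v \<noteq> 0}"

definition orth_proj :: "(complex^'n) set \<Rightarrow> complex^'n^'n" where
  "orth_proj S = (THE P. hermitian P \<and> P ** P = P \<and> range (\<lambda>v. P *v v) = S)"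

text \<open>
  Functional calculus through the spectral decomposition, meaningful for Hermitian \<open>A\<close>
  (whose eigenvalues are all real).
\<close>

definition spectral_fun :: "(real \<Rightarrow> real) \<Rightarrow> complex^'n^'n \<Rightarrow> complex^'n^'n" where
  "spectral_fun f A = (\<Sum>\<mu>\<in>real_spectrum A. f \<mu> *\<^sub>R orth_proj (eigenspace A \<mu>))"

text \<open>
  The logarithm of a positive semi-definite matrix is taken on its range and extended by zero to
  its kernel. This implements both \<open>0 log 0 = 0\<close> in \<open>\<gamma> log \<gamma>\<close> and the evaluation of
  \<open>Tr (\<gamma>\<^sub>1 log \<gamma>\<^sub>2)\<close> on the range of \<open>\<gamma>\<^sub>2\<close>.
\<close>

definition mat_log :: "complex^'n^'n \<Rightarrow> complex^'n^'n" where
  "mat_log A = spectral_fun (\<lambda>x. if x = 0 then 0 else ln x) A"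

text \<open>
  In the definitions below all traces are real for Hermitian arguments, so \<open>Re\<close> only
  converts the type.
\<close>

definition vn_entropy :: "complex^'n^'n \<Rightarrow> real" where
  "vn_entropy G = Re (trace (G ** (mat_log G - mat 1)))"

definition rel_entropy :: "complex^'n^'n \<Rightarrow> complex^'n^'n \<Rightarrow> ereal" where
  "rel_entropy A B =
     (if mat_kernel B \<subseteq> mat_kernel A
      then ereal (Re (trace (A ** (mat_log A - mat_log B - mat 1) + B)))
      else \<infinity>)"

definition unbalanced_qot ::
  "complex^('m::finite \<times> 'n::finite)^('m \<times> 'n) \<Rightarrow> real \<Rightarrow> real \<Rightarrow> real \<Rightarrow>
   complex^'m^'m \<Rightarrow> complex^'n^'n \<Rightarrow> complex^('m \<times> 'n)^('m \<times> 'n) \<Rightarrow> ereal" where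
  "unbalanced_qot C \<epsilon> \<tau>\<^sub>1 \<tau>\<^sub>2 \<rho> \<sigma> G =
     ereal (Re (trace (C ** G)) + \<epsilon> * vn_entropy G)
     + ereal \<tau>\<^sub>1 * rel_entropy (ptrace_snd G) \<rho>
     + ereal \<tau>\<^sub>2 * rel_entropy (ptrace_fst G) \<sigma>"

end

(*
  A Hermitian matrix is U diag(d) U* with U unitary, and Tr[A log A] is then the sum of d_i log d_i.
  Positive semi-definite matrices of trace at most R are the continuous image of a compact set of
  pairs (U, d), so Tr[A log A] is continuous on them and each sublevel problem is compact. From
  x log x >= M x - exp (M - 1) with M large the entropy beats every linear term, all of which are
  bounded by a multiple of Tr[Gamma]; hence minimizing over a bounded trace loses nothing. The kernel
  conditions cut out a closed set containing 0, off which the objective is infinite.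
*)

theory Submission imports Defs "HOL-Real_Asymp.Real_Asymp" begin

section \<open>Adjoints, the complex inner product, orthonormal eigenvectors\<close>

lemma cadjoint_mult: "cadjoint (A ** B) = cadjoint B ** cadjoint A"
  by (simp add: cadjoint_def matrix_matrix_mult_def vec_eq_iff mult.commute)

lemma cadjoint_cadjoint [simp]: "cadjoint (cadjoint A) = A"
  by (simp add: cadjoint_def vec_eq_iff)

lemma hermitian_nth: "hermitian A \<Longrightarrow> cnj (A $ i $ j) = A $ j $ i"
  by (simp add: hermitian_def cadjoint_def vec_eq_iff)

lemma cinner_vec_mult: "cinner_vec v (A *v w) = cinner_vec (cadjoint A *v v) w"
proof -
  have "cinner_vec v (A *v w) = (\<Sum>i\<in>UNIV. \<Sum>j\<in>UNIV. cnj (v $ i) * (A $ i $ j * w $ j))"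
    by (simp add: cinner_vec_def matrix_vector_mult_def sum_distrib_left)
  also have "\<dots> = (\<Sum>j\<in>UNIV. \<Sum>i\<in>UNIV. cnj (v $ i) * (A $ i $ j * w $ j))"
    by (rule sum.swap)
  also have "\<dots> = cinner_vec (cadjoint A *v v) w"
    by (simp add: cinner_vec_def matrix_vector_mult_def cadjoint_def sum_distrib_left mult_ac)
  finally show ?thesis .
qed

lemma cinner_vec_self: "cinner_vec v v = complex_of_real ((norm v)\<^sup>2)"
proof -
  have "cinner_vec v v = (\<Sum>i\<in>UNIV. complex_of_real ((norm (v $ i))\<^sup>2))"
    unfolding cinner_vec_def
    by (intro sum.cong refl) (simp add: complex_norm_square mult.commute flip: of_real_power)
  also have "\<dots> = complex_of_real ((norm v)\<^sup>2)"
    by (simp add: norm_vec_def L2_set_def sum_nonneg)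
  finally show ?thesis .
qed

text \<open>Makes a Hermitian matrix self-adjoint for the real inner product too, so that
  eigenvectors can be sought in the real Euclidean space \<open>complex^'n\<close>.\<close>

lemma inner_eq_Re_cinner_vec: "v \<bullet> w = Re (cinner_vec v w)"
  by (simp add: inner_vec_def cinner_vec_def inner_complex_def)

lemma cinner_vec_add_right: "cinner_vec v (w + x) = cinner_vec v w + cinner_vec v x"
  by (simp add: cinner_vec_def algebra_simps sum.distrib)

lemma cinner_vec_scale_right: "cinner_vec v (c *s w) = c * cinner_vec v w"
  by (simp add: cinner_vec_def sum_distrib_left mult_ac)

lemma cinner_vec_commute: "cinner_vec w v = cnj (cinner_vec v w)"
  by (simp add: cinner_vec_def mult.commute)

lemma scaleR_eq_vector_smult: "r *\<^sub>R (v :: complex^'n) = complex_of_real r *s v"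
  by (simp add: vec_eq_iff) (simp add: scaleR_conv_of_real)

text \<open>
  A maximizer of the Rayleigh quotient on an invariant subspace is an eigenvector, because the
  form \<open>\<lambda> \<parallel>w\<parallel>\<^sup>2 - \<langle>w, T w\<rangle>\<close> is positive semi-definite and vanishes there.
\<close>

lemma selfadjoint_eigenvector:
  fixes T :: "'a::euclidean_space \<Rightarrow> 'a"
  assumes lin: "linear T" and sym: "\<And>v w. T v \<bullet> w = v \<bullet> T w"
    and W: "subspace W" and inv: "\<And>w. w \<in> W \<Longrightarrow> T w \<in> W" and nz: "x \<in> W" "x \<noteq> 0"
  obtains v l where "v \<in> W" "norm v = 1" "T v = l *\<^sub>R v"
proof -
  interpret T: linear T by fact
  let ?S = "W \<inter> sphere 0 1"
  have "compact ?S"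
    by (intro closed_Int_compact closed_subspace W compact_sphere)
  moreover have "x /\<^sub>R norm x \<in> ?S"
    using nz W by (simp add: subspace_scale)
  moreover have "continuous_on ?S (\<lambda>v. v \<bullet> T v)"
    by (intro continuous_intros linear_continuous_on) (simp add: lin linear_conv_bounded_linear[symmetric])
  ultimately obtain v where v: "v \<in> ?S" and max: "\<And>w. w \<in> ?S \<Longrightarrow> w \<bullet> T w \<le> v \<bullet> T v"
    using continuous_attains_sup[of ?S "\<lambda>v. v \<bullet> T v"] by blast
  define l where "l = v \<bullet> T v"
  have vW: "v \<in> W" and nv: "v \<bullet> v = 1"
    using v by (auto simp: norm_eq_1)
  have q: "w \<bullet> T w \<le> l * (w \<bullet> w)" if "w \<in> W" for w
  proof (cases "w = 0")
    case False
    then have "w /\<^sub>R norm w \<in> ?S"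
      using that W by (simp add: subspace_scale)
    from max[OF this] have "(w \<bullet> T w) / (norm w)\<^sup>2 \<le> l"
      by (simp add: T.scale l_def power2_eq_square divide_simps)
    with False show ?thesis
      by (simp add: divide_simps dot_square_norm)
  qed (simp add: T.zero)
  define z where "z = l *\<^sub>R v - T v"
  have zW: "z \<in> W"
    unfolding z_def by (intro subspace_diff subspace_scale W vW inv)
  \<comment> \<open>Moves from \<open>v\<close> along the residual \<open>z\<close>: the constant
    term vanishes because \<open>v\<close> attains \<open>l\<close>, and the first-order coefficient
    is \<open>2 * (z \<bullet> z)\<close>.\<close>
  have *: "0 \<le> 2 * t * (z \<bullet> z) + t\<^sup>2 * (l * (z \<bullet> z) - z \<bullet> T z)" for t
  proof -
    have "v + t *\<^sub>R z \<in> W"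
      by (intro subspace_add subspace_scale W vW zW)
    from q[OF this] have "0 \<le> l * ((v + t *\<^sub>R z) \<bullet> (v + t *\<^sub>R z)) - (v + t *\<^sub>R z) \<bullet> T (v + t *\<^sub>R z)"
      by simp
    also have "\<dots> = 2 * t * (l * (v \<bullet> z) - T v \<bullet> z) + t\<^sup>2 * (l * (z \<bullet> z) - z \<bullet> T z)"
      using sym[of v z]
      by (simp add: T.add T.scale inner_simps nv l_def[symmetric] inner_commute power2_eq_square algebra_simps)
    also have "l * (v \<bullet> z) - T v \<bullet> z = z \<bullet> z"
      using sym[of v v] sym[of v "T v"] by (simp add: z_def inner_simps algebra_simps)
    finally show ?thesis .
  qed
  have "z = 0"
  proof (rule ccontr)
    assume "z \<noteq> 0"
    define a b where "a = z \<bullet> z" and "b = l * (z \<bullet> z) - z \<bullet> T z"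
    have a: "a > 0" using \<open>z \<noteq> 0\<close> by (simp add: a_def)
    have b: "b \<ge> 0" using q[OF zW] by (simp add: b_def)
    \<comment> \<open>At this small negative \<open>t\<close> the linear term wins unless
      \<open>z = 0\<close>; the \<open>+ 1\<close> keeps the denominator positive even if
      \<open>b = 0\<close>.\<close>
    have "0 \<le> 2 * (- a / (b + 1)) * a + (- a / (b + 1))\<^sup>2 * b"
      using *[of "- a / (b + 1)"] by (simp add: a_def b_def)
    also have "\<dots> = - (a\<^sup>2 * (b + 2)) / (b + 1)\<^sup>2"
      using b by (simp add: divide_simps power2_eq_square) (simp add: algebra_simps)
    finally show False
      using a b by (simp add: divide_simps split: if_splits) (smt (verit) mult_pos_pos zero_less_power)
  qed
  then have "T v = l *\<^sub>R v"
    by (simp add: z_def)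
  with that vW nv show ?thesis
    by (auto simp: norm_eq_1)
qed

text \<open>Induction on the index set: the vectors orthogonal to those already found form an
  invariant subspace, because \<open>A\<close> is Hermitian, and it is nonzero while an index is
  left over. Indexing by subsets of \<open>'n\<close> makes \<open>I = UNIV\<close> a full
  eigenbasis.\<close>

lemma hermitian_orthonormal_eigenvectors:
  fixes A :: "complex^'n^'n" and I :: "'n set"
  assumes "hermitian A"
  shows "\<exists>u d. \<forall>i\<in>I. A *v u i = complex_of_real (d i) *s u i \<and>
           (\<forall>j\<in>I. cinner_vec (u i) (u j) = (if i = j then 1 else 0))"
  using finite[of I]
proof (induction I rule: finite_induct)
  case (insert k I)
  then obtain u d where u: "\<And>i. i \<in> I \<Longrightarrow> A *v u i = complex_of_real (d i) *s u i"
    and orth: "\<And>i j. i \<in> I \<Longrightarrow> j \<in> I \<Longrightarrow> cinner_vec (u i) (u j) = (if i = j then 1 else 0)"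
    by metis
  have adj: "cinner_vec (A *v v) w = cinner_vec v (A *v w)" for v w
    using assms by (simp add: cinner_vec_mult hermitian_def)
  let ?W = "{w. \<forall>i\<in>I. cinner_vec (u i) w = 0}"
  \<comment> \<open>The rows are the conjugates of the vectors found so far, padded with zeros. Row
    \<open>k\<close> is zero since \<open>k\<close> is not in \<open>I\<close>, so there is a
    nonzero kernel vector, and it is orthogonal to every \<open>u i\<close>.\<close>
  define M :: "complex^'n^'n" where "M = (\<chi> i j. if i \<in> I then cnj (u i $ j) else 0)"
  have "det M = 0"
    using insert.hyps by (intro det_zero_row(1)[of k]) (simp add: M_def row_def vec_eq_iff)
  then have "\<not> (\<forall>x. M *v x = 0 \<longrightarrow> x = 0)"
    by (metis invertible_det_nz invertible_left_inverse matrix_left_invertible_ker)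
  then obtain x where x: "M *v x = 0" "x \<noteq> 0" by blast
  have "cinner_vec (u i) x = (M *v x) $ i" if "i \<in> I" for i
    using that by (simp add: M_def cinner_vec_def matrix_vector_mult_def)
  then have xW: "x \<in> ?W" using x by simp
  have W: "subspace ?W"
    by (auto simp: subspace_def cinner_vec_add_right scaleR_eq_vector_smult cinner_vec_scale_right)
       (simp add: cinner_vec_def)
  have inv: "A *v w \<in> ?W" if "w \<in> ?W" for w
    using that u by (auto simp: adj[symmetric])
      (metis cinner_vec_commute cinner_vec_scale_right complex_cnj_zero mult_zero_right)
  obtain v l where v: "v \<in> ?W" "norm v = 1" "A *v v = l *\<^sub>R v"
    by (rule selfadjoint_eigenvector[of "(*v) A" ?W x])
       (use W inv xW x in \<open>auto simp: inner_eq_Re_cinner_vec adj\<close>)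
  have vv: "cinner_vec v v = 1"
    by (simp add: cinner_vec_self v)
  have vu: "cinner_vec v (u i) = 0" if "i \<in> I" for i
    using v(1) that cinner_vec_commute[of v "u i"] by simp
  show ?case
    by (rule exI[of _ "u(k := v)"], rule exI[of _ "d(k := l)"])
      (use v vv vu u orth insert.hyps in \<open>auto simp: scaleR_eq_vector_smult\<close>)
qed simp


section \<open>Unitary diagonalization and the functional calculus\<close>

definition real_diag :: "real^'n \<Rightarrow> complex^'n^'n" where
  "real_diag d = (\<chi> i j. if i = j then complex_of_real (d $ i) else 0)"

definition unitary_matrices :: "(complex^'n^'n) set" where
  "unitary_matrices = {U. cadjoint U ** U = mat 1}"

definition unitary_conj :: "complex^'n^'n \<Rightarrow> real^'n \<Rightarrow> complex^'n^'n" where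
  "unitary_conj U d = U ** real_diag d ** cadjoint U"

lemma unitary_matrices_right:
  "U \<in> unitary_matrices \<Longrightarrow> U ** cadjoint U = mat 1"
  by (simp add: unitary_matrices_def matrix_left_right_inverse)

lemma real_diag_mult: "real_diag d ** real_diag e = real_diag (d * e)"
  by (simp add: real_diag_def matrix_matrix_mult_def vec_eq_iff if_distrib[of "\<lambda>x. _ * x"]
      if_distrib[of "\<lambda>x. x * _"] cong: if_cong)

lemma cadjoint_real_diag: "cadjoint (real_diag d) = real_diag d"
  by (simp add: cadjoint_def real_diag_def vec_eq_iff)

lemma real_diag_vec: "(real_diag d *v v) $ i = complex_of_real (d $ i) * v $ i"
  by (simp add: real_diag_def matrix_vector_mult_def if_distrib[of "\<lambda>x. x * _"] cong: if_cong)

lemma hermitian_unitary_conj: "hermitian (unitary_conj U d)"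
  by (simp add: hermitian_def unitary_conj_def cadjoint_mult cadjoint_real_diag matrix_mul_assoc)

text \<open>For unitary \<open>U\<close> this is the expansion into rank-one projections onto the
  columns of \<open>U\<close>. Its linearity in \<open>d\<close> serves the functional calculus and
  the entry bounds.\<close>

lemma unitary_conj_nth:
  "unitary_conj U d $ a $ b = (\<Sum>i\<in>UNIV. complex_of_real (d $ i) * (U $ a $ i * cnj (U $ b $ i)))"
  by (simp add: unitary_conj_def real_diag_def cadjoint_def matrix_matrix_mult_def
      if_distrib[of "\<lambda>x. _ * x"] mult_ac cong: if_cong)

lemma unitary_conj_mult:
  assumes "U \<in> unitary_matrices"
  shows "unitary_conj U d ** unitary_conj U e = unitary_conj U (d * e)"
proof -
  have "unitary_conj U d ** unitary_conj U e
      = U ** real_diag d ** (cadjoint U ** U) ** real_diag e ** cadjoint U"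
    by (simp add: unitary_conj_def matrix_mul_assoc)
  then show ?thesis
    using assms by (simp add: unitary_matrices_def unitary_conj_def flip: real_diag_mult)
      (simp add: matrix_mul_assoc)
qed

lemma trace_mult_commute:
  fixes A B :: "'a::comm_semiring_1^'n^'n"
  shows "trace (A ** B) = trace (B ** A)"
  unfolding trace_def matrix_matrix_mult_def
  by (simp add: mult.commute) (rule sum.swap)

lemma trace_unitary_conj:
  assumes "U \<in> unitary_matrices"
  shows "trace (unitary_conj U d) = complex_of_real (\<Sum>i\<in>UNIV. d $ i)"
proof -
  have "trace (unitary_conj U d) = trace (cadjoint U ** U ** real_diag d)"
    unfolding unitary_conj_def
    by (subst trace_mult_commute) (simp add: matrix_mul_assoc)
  then show ?thesis
    using assms by (simp add: unitary_matrices_def) (simp add: trace_def real_diag_def)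
qed

text \<open>In the coordinates \<open>cadjoint U *v v\<close> the operator is diagonal. This
  criterion yields the spectrum, the eigenspaces and, at eigenvalue 1, the ranges of the spectral
  projections.\<close>

lemma unitary_conj_vec_eq_iff:
  assumes "U \<in> unitary_matrices"
  shows "unitary_conj U d *v v = complex_of_real \<mu> *s v
     \<longleftrightarrow> (\<forall>i. d $ i = \<mu> \<or> (cadjoint U *v v) $ i = 0)"
proof -
  define w where "w = cadjoint U *v v"
  have v: "v = U *v w"
    by (simp add: w_def matrix_vector_mul_assoc unitary_matrices_right assms)
  have UU: "cadjoint U *v (U *v x) = x" for x
    using assms by (simp add: matrix_vector_mul_assoc unitary_matrices_def)
  have *: "U *v x = U *v y \<longleftrightarrow> x = y" for x y
    by (metis UU)
  have "unitary_conj U d *v v = U *v (real_diag d *v w)"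
    by (simp add: unitary_conj_def w_def matrix_vector_mul_assoc matrix_mul_assoc)
  moreover have "complex_of_real \<mu> *s v = U *v (complex_of_real \<mu> *s w)"
    unfolding v by (simp add: matrix_vector_mult_def vec_eq_iff sum_distrib_left mult_ac)
  ultimately have "unitary_conj U d *v v = complex_of_real \<mu> *s v \<longleftrightarrow>
      real_diag d *v w = complex_of_real \<mu> *s w"
    by (simp add: *)
  also have "\<dots> \<longleftrightarrow> (\<forall>i. d $ i = \<mu> \<or> w $ i = 0)"
    by (auto simp: vec_eq_iff real_diag_vec)
  finally show ?thesis by (simp add: w_def)
qed

lemma spectral_theorem:
  fixes A :: "complex^'n^'n"
  assumes "hermitian A"
  obtains U d where "U \<in> unitary_matrices" "A = unitary_conj U d"
proof -
  obtain u :: "'n \<Rightarrow> complex^'n" and d where "\<forall>i\<in>UNIV. A *v u i = complex_of_real (d i) *s u i \<and>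
      (\<forall>j\<in>UNIV. cinner_vec (u i) (u j) = (if i = j then 1 else 0))"
    using hermitian_orthonormal_eigenvectors[OF assms] by blast
  then have u: "A *v u i = complex_of_real (d i) *s u i"
    and orth: "cinner_vec (u i) (u j) = (if i = j then 1 else 0)" for i j
    by simp_all
  \<comment> \<open>The eigenvectors become the columns: orthonormality gives unitarity, and the
    eigenvalue equations become \<open>A ** U = U ** real_diag e\<close>.\<close>
  define U :: "complex^'n^'n" where "U = (\<chi> a i. u i $ a)"
  define e :: "real^'n" where "e = (\<chi> i. d i)"
  have "cadjoint U ** U = mat 1"
    using orth by (simp add: U_def cadjoint_def matrix_matrix_mult_def mat_def vec_eq_iff
        cinner_vec_def)
  then have U: "U \<in> unitary_matrices"
    by (simp add: unitary_matrices_def)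
  have "(A ** U) $ a $ i = (U ** real_diag e) $ a $ i" for a i
    using arg_cong[OF u[of i], of "\<lambda>v. v $ a"]
    by (simp add: matrix_matrix_mult_def matrix_vector_mult_def U_def real_diag_def e_def
        if_distrib[of "\<lambda>x. _ * x"] mult.commute cong: if_cong)
  then have "A ** U = U ** real_diag e"
    by (simp add: vec_eq_iff)
  then have "A = unitary_conj U e"
    by (metis U unitary_conj_def matrix_mul_assoc matrix_mul_rid unitary_matrices_right)
  with U show ?thesis by (rule that)
qed

text \<open>Evaluates the \<open>THE\<close> in \<open>orth_proj\<close>. Projections with the same
  range fix each other's images, so \<open>P ** Q = Q\<close> and \<open>Q ** P = P\<close>; the
  adjoint of the first equation is \<open>Q ** P = Q\<close>, whence \<open>Q = P\<close>.\<close>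

lemma orth_proj_eqI:
  assumes "hermitian P" "P ** P = P" "range (\<lambda>v. P *v v) = S"
  shows "orth_proj S = P"
  unfolding orth_proj_def
proof (rule the_equality)
  have absorb: "X ** Y = Y" if idem: "X ** X = X" and ran: "range (\<lambda>v. X *v v) = range (\<lambda>v. Y *v v)"
    for X Y :: "complex^'a^'a"
  proof -
    have "(X ** Y) *v v = Y *v v" for v
    proof -
      obtain w where "Y *v v = X *v w"
        using ran by (metis rangeE rangeI)
      then show ?thesis
        by (metis matrix_vector_mul_assoc idem)
    qed
    then show ?thesis by (simp add: matrix_eq)
  qed
  fix Q assume Q: "hermitian Q \<and> Q ** Q = Q \<and> range (\<lambda>v. Q *v v) = S"
  have "P ** Q = Q" "Q ** P = P"
    using absorb[of P Q] absorb[of Q P] Q assms by auto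
  then show "Q = P"
    using Q assms by (metis cadjoint_mult hermitian_def)
qed (use assms in blast)

lemma real_spectrum_unitary_conj:
  assumes "U \<in> unitary_matrices"
  shows "real_spectrum (unitary_conj U d) = range (($) d)"
proof (intro equalityI subsetI)
  fix \<mu> assume "\<mu> \<in> real_spectrum (unitary_conj U d)"
  then obtain v where "v \<noteq> 0" "\<And>i. d $ i = \<mu> \<or> (cadjoint U *v v) $ i = 0"
    using unitary_conj_vec_eq_iff[OF assms] by (auto simp: real_spectrum_def eigenspace_def)
  moreover have "cadjoint U *v v \<noteq> 0"
    using \<open>v \<noteq> 0\<close> unitary_matrices_right[OF assms]
    by (metis matrix_vector_mul_assoc matrix_vector_mul_lid matrix_vector_mult_0_right)
  ultimately show "\<mu> \<in> range (($) d)"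
    by (auto simp: vec_eq_iff) (metis rangeI)
next
  fix \<mu> assume "\<mu> \<in> range (($) d)"
  then obtain k where k: "\<mu> = d $ k" by blast
  \<comment> \<open>The eigenvector for \<open>d $ k\<close> is column \<open>k\<close> of
    \<open>U\<close>.\<close>
  have *: "cadjoint U *v (U *v axis k 1) = axis k 1"
    using assms by (simp add: matrix_vector_mul_assoc unitary_matrices_def)
  then have "U *v axis k 1 \<noteq> 0"
    by (metis axis_eq_0_iff matrix_vector_mult_0_right zero_neq_one)
  moreover have "U *v axis k 1 \<in> eigenspace (unitary_conj U d) \<mu>"
    unfolding eigenspace_def using unitary_conj_vec_eq_iff[OF assms] *
    by (auto simp: k axis_def)
  ultimately show "\<mu> \<in> real_spectrum (unitary_conj U d)"
    by (auto simp: real_spectrum_def)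
qed

lemma orth_proj_eigenspace_unitary_conj:
  assumes "U \<in> unitary_matrices"
  shows "orth_proj (eigenspace (unitary_conj U d) \<mu>)
    = unitary_conj U (\<chi> i. if d $ i = \<mu> then 1 else 0)" (is "_ = unitary_conj U ?e")
proof (rule orth_proj_eqI)
  have "?e * ?e = ?e"
    by (simp add: vec_eq_iff)
  then show idem: "unitary_conj U ?e ** unitary_conj U ?e = unitary_conj U ?e"
    by (simp add: unitary_conj_mult assms)
  \<comment> \<open>An idempotent's range is its fixed space, so the eigenvector criterion applies
    at eigenvalue 1.\<close>
  have "v \<in> range (\<lambda>v. unitary_conj U ?e *v v) \<longleftrightarrow> unitary_conj U ?e *v v = complex_of_real 1 *s v" for v
    by (auto simp: matrix_vector_mul_assoc idem) (metis rangeI)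
  also have "unitary_conj U ?e *v v = complex_of_real 1 *s v \<longleftrightarrow>
      v \<in> eigenspace (unitary_conj U d) \<mu>" for v
    unfolding unitary_conj_vec_eq_iff[OF assms] eigenspace_def by auto
  finally show "range (\<lambda>v. unitary_conj U ?e *v v) = eigenspace (unitary_conj U d) \<mu>"
    by blast
qed (rule hermitian_unitary_conj)

text \<open>The spectrum is a set, so equal entries of \<open>d\<close> share one summand of the
  definition. After the two sums are exchanged, each index \<open>i\<close> meets exactly one
  \<open>\<mu>\<close>, namely \<open>d $ i\<close>.\<close>

lemma spectral_fun_unitary_conj:
  assumes "U \<in> unitary_matrices"
  shows "spectral_fun f (unitary_conj U d) = unitary_conj U (\<chi> i. f (d $ i))"
proof -
  have "spectral_fun f (unitary_conj U d) $ a $ b = unitary_conj U (\<chi> i. f (d $ i)) $ a $ b" for a b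
  proof -
    have "spectral_fun f (unitary_conj U d) $ a $ b
      = (\<Sum>\<mu>\<in>range (($) d). f \<mu> *\<^sub>R (\<Sum>i\<in>UNIV. (if d $ i = \<mu> then 1 else 0) * (U $ a $ i * cnj (U $ b $ i))))"
      by (simp add: spectral_fun_def real_spectrum_unitary_conj assms
          orth_proj_eigenspace_unitary_conj unitary_conj_nth if_distrib[of complex_of_real] cong: if_cong)
    also have "\<dots> = (\<Sum>\<mu>\<in>range (($) d). \<Sum>i\<in>UNIV.
        if \<mu> = d $ i then complex_of_real (f (d $ i)) * (U $ a $ i * cnj (U $ b $ i)) else 0)"
      by (intro sum.cong refl) (auto simp: scaleR_conv_of_real sum_distrib_left intro!: sum.cong)
    also have "\<dots> = (\<Sum>i\<in>UNIV. \<Sum>\<mu>\<in>range (($) d).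
        if \<mu> = d $ i then complex_of_real (f (d $ i)) * (U $ a $ i * cnj (U $ b $ i)) else 0)"
      by (rule sum.swap)
    also have "\<dots> = unitary_conj U (\<chi> i. f (d $ i)) $ a $ b"
      by (simp add: unitary_conj_nth)
    finally show ?thesis .
  qed
  then show ?thesis by (simp add: vec_eq_iff)
qed

section \<open>Positive semi-definite matrices and the trace of A log A\<close>

lemma cinner_vec_unitary_conj:
  "cinner_vec v (unitary_conj U d *v v)
    = complex_of_real (\<Sum>i\<in>UNIV. d $ i * (norm ((cadjoint U *v v) $ i))\<^sup>2)"
proof -
  have "unitary_conj U d *v v = U *v (real_diag d *v (cadjoint U *v v))"
    by (simp add: unitary_conj_def matrix_vector_mul_assoc matrix_mul_assoc)
  then have "cinner_vec v (unitary_conj U d *v v)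
      = cinner_vec (cadjoint U *v v) (real_diag d *v (cadjoint U *v v))"
    by (simp add: cinner_vec_mult)
  also have "\<dots> = (\<Sum>i\<in>UNIV. complex_of_real (d $ i * (norm ((cadjoint U *v v) $ i))\<^sup>2))"
    unfolding cinner_vec_def
    by (intro sum.cong refl) (simp add: real_diag_vec complex_norm_square mult_ac flip: of_real_power)
  finally show ?thesis by simp
qed

lemma unitary_conj_herm_psd_iff:
  assumes "U \<in> unitary_matrices"
  shows "unitary_conj U d \<in> herm_psd \<longleftrightarrow> (\<forall>i. 0 \<le> d $ i)"
proof
  assume psd: "unitary_conj U d \<in> herm_psd"
  show "\<forall>i. 0 \<le> d $ i"
  proof
    \<comment> \<open>The quadratic form at column \<open>k\<close> of \<open>U\<close> has the
      value \<open>d $ k\<close>.\<close>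
    fix k
    have "cadjoint U *v (U *v axis k 1) = axis k 1"
      using assms by (simp add: matrix_vector_mul_assoc unitary_matrices_def)
    then have "Re (cinner_vec (U *v axis k 1) (unitary_conj U d *v (U *v axis k 1)))
        = (\<Sum>i\<in>UNIV. if i = k then d $ i else 0)"
      by (simp only: cinner_vec_unitary_conj Re_complex_of_real)
        (intro sum.cong refl, simp add: axis_def)
    moreover have "0 \<le> Re (cinner_vec (U *v axis k 1) (unitary_conj U d *v (U *v axis k 1)))"
      using psd by (simp add: herm_psd_def)
    ultimately show "0 \<le> d $ k" by simp
  qed
next
  assume "\<forall>i. 0 \<le> d $ i"
  then show "unitary_conj U d \<in> herm_psd"
    by (simp add: herm_psd_def hermitian_unitary_conj cinner_vec_unitary_conj sum_nonneg)
qed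

lemma herm_psd_spectral_theorem:
  assumes "A \<in> herm_psd"
  obtains U d where "U \<in> unitary_matrices" "\<And>i. 0 \<le> d $ i" "A = unitary_conj U d"
proof -
  have "hermitian A"
    using assms by (simp add: herm_psd_def)
  then obtain U d where U: "U \<in> unitary_matrices" and A: "A = unitary_conj U d"
    by (rule spectral_theorem)
  moreover have "0 \<le> d $ i" for i
    using assms unfolding A unitary_conj_herm_psd_iff[OF U] by blast
  ultimately show ?thesis using that by metis
qed

text \<open>The only nonlinear ingredient of the objective: where finite, both entropies differ from
  it by affine terms.\<close>

definition xlogx_trace :: "complex^'n^'n \<Rightarrow> real" where
  "xlogx_trace A = Re (trace (A ** mat_log A))"

lemma xlogx_trace_unitary_conj:
  assumes "U \<in> unitary_matrices"
  shows "xlogx_trace (unitary_conj U d) = (\<Sum>i\<in>UNIV. d $ i * ln (d $ i))"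
  \<comment> \<open>The zero case in \<open>mat_log\<close> disappears because its value is
    multiplied by \<open>d $ i = 0\<close>.\<close>
  by (auto simp: xlogx_trace_def mat_log_def spectral_fun_unitary_conj unitary_conj_mult
      trace_unitary_conj assms intro!: sum.cong)

section \<open>Compactness under a trace bound and continuity of A log A\<close>

definition psd_trace_le :: "real \<Rightarrow> (complex^'n^'n) set" where
  "psd_trace_le R = {A \<in> herm_psd. Re (trace A) \<le> R}"

text \<open>Eigenvectors need not depend continuously on the matrix, whereas the matrix depends
  continuously on the pair; hence the parametrization by pairs.\<close>

definition spectral_data :: "real \<Rightarrow> ((complex^'n^'n) \<times> (real^'n)) set" where
  "spectral_data R = unitary_matrices \<times> {d. (\<forall>i. 0 \<le> d $ i) \<and> (\<Sum>i\<in>UNIV. d $ i) \<le> R}"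

lemma psd_trace_le_eq_image:
  "psd_trace_le R = (\<lambda>(U, d). unitary_conj U d) ` spectral_data R"
proof (intro equalityI subsetI)
  fix A :: "complex^'a^'a" assume A: "A \<in> psd_trace_le R"
  then have "A \<in> herm_psd"
    by (simp add: psd_trace_le_def)
  then obtain U d where U: "U \<in> unitary_matrices" and d: "\<forall>i. 0 \<le> d $ i" and eq: "A = unitary_conj U d"
    by (blast elim: herm_psd_spectral_theorem)
  have "(\<Sum>i\<in>UNIV. d $ i) \<le> R"
    using A by (simp add: psd_trace_le_def eq trace_unitary_conj U)
  then show "A \<in> (\<lambda>(U, d). unitary_conj U d) ` spectral_data R"
    using U d eq by (intro image_eqI[of _ _ "(U, d)"]) (simp_all add: spectral_data_def)
next
  fix A :: "complex^'a^'a" assume "A \<in> (\<lambda>(U, d). unitary_conj U d) ` spectral_data R"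
  then obtain U d where U: "U \<in> unitary_matrices" and "\<forall>i. 0 \<le> d $ i" "(\<Sum>i\<in>UNIV. d $ i) \<le> R"
    and "A = unitary_conj U d"
    by (auto simp: spectral_data_def)
  then show "A \<in> psd_trace_le R"
    by (simp add: psd_trace_le_def trace_unitary_conj unitary_conj_herm_psd_iff)
qed

text \<open>Each row of \<open>U\<close> has unit length, by the diagonal entries of
  \<open>U ** cadjoint U = mat 1\<close>.\<close>

lemma norm_unitary_nth_le_1:
  assumes "U \<in> unitary_matrices"
  shows "norm (U $ a $ i) \<le> 1"
proof -
  have "(\<Sum>j\<in>UNIV. U $ a $ j * cnj (U $ a $ j)) = 1"
    using unitary_matrices_right[OF assms]
    by (simp add: vec_eq_iff matrix_matrix_mult_def cadjoint_def mat_def)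
  then have "complex_of_real (\<Sum>j\<in>UNIV. (norm (U $ a $ j))\<^sup>2) = 1"
    by (simp only: of_real_sum complex_norm_square)
  then have "(\<Sum>j\<in>UNIV. (norm (U $ a $ j))\<^sup>2) = 1"
    using of_real_eq_1_iff by blast
  moreover have "(norm (U $ a $ i))\<^sup>2 \<le> (\<Sum>j\<in>UNIV. (norm (U $ a $ j))\<^sup>2)"
    by (intro member_le_sum) auto
  ultimately have "(norm (U $ a $ i))\<^sup>2 \<le> 1" by simp
  then show ?thesis
    by (simp add: power_le_one_iff)
qed

lemma continuous_on_matrix_mult [continuous_intros]:
  fixes f :: "'a::topological_space \<Rightarrow> complex^'m^'n" and g :: "'a \<Rightarrow> complex^'k^'m"
  assumes "continuous_on S f" "continuous_on S g"
  shows "continuous_on S (\<lambda>x. f x ** g x)"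
  unfolding matrix_matrix_mult_def by (intro continuous_intros assms)

lemma continuous_on_cadjoint [continuous_intros]:
  assumes "continuous_on S f"
  shows "continuous_on S (\<lambda>x. cadjoint (f x))"
  unfolding cadjoint_def by (intro continuous_intros assms)

lemma continuous_on_trace [continuous_intros]:
  fixes f :: "'a::topological_space \<Rightarrow> complex^'n^'n"
  assumes "continuous_on S f"
  shows "continuous_on S (\<lambda>x. trace (f x))"
  unfolding trace_def by (intro continuous_intros assms)

lemma continuous_on_real_diag [continuous_intros]:
  assumes "continuous_on S f"
  shows "continuous_on S (\<lambda>x. real_diag (f x))"
proof -
  have "continuous_on S (\<lambda>x. if i = j then complex_of_real (f x $ i) else 0)" for i j
    by (cases "i = j") (auto intro!: continuous_intros assms)
  then show ?thesis
    unfolding real_diag_def by (intro continuous_intros)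
qed

lemma continuous_on_unitary_conj:
  "continuous_on S (\<lambda>(U, d). unitary_conj U d)"
  unfolding unitary_conj_def case_prod_unfold by (intro continuous_intros)

lemma compact_spectral_data: "compact (spectral_data R :: ((complex^'n^'n) \<times> (real^'n)) set)"
  unfolding spectral_data_def
proof (rule compact_Times; unfold compact_eq_bounded_closed; intro conjI)
  show "bounded (unitary_matrices :: (complex^'n^'n) set)"
    unfolding bounded_iff
  proof (intro exI ballI)
    fix U :: "complex^'n^'n" assume U: "U \<in> unitary_matrices"
    have "norm U \<le> (\<Sum>a\<in>UNIV. norm (U $ a))"
      unfolding norm_vec_def[of U] by (intro L2_set_le_sum) simp
    also have "\<dots> \<le> (\<Sum>a\<in>UNIV. \<Sum>i\<in>UNIV. norm (U $ a $ i))"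
      unfolding norm_vec_def[of "U $ _"] by (intro sum_mono L2_set_le_sum) simp
    also have "\<dots> \<le> (\<Sum>a\<in>(UNIV::'n set). \<Sum>i\<in>(UNIV::'n set). 1)"
      by (intro sum_mono norm_unitary_nth_le_1 U)
    finally show "norm U \<le> (\<Sum>a\<in>(UNIV::'n set). \<Sum>i\<in>(UNIV::'n set). 1)" .
  qed
  show "closed (unitary_matrices :: (complex^'n^'n) set)"
    unfolding unitary_matrices_def by (intro closed_Collect_eq continuous_intros)
  show "closed {d :: real^'n. (\<forall>i. 0 \<le> d $ i) \<and> (\<Sum>i\<in>UNIV. d $ i) \<le> R}"
    by (intro closed_Collect_conj closed_Collect_all closed_Collect_le continuous_intros)
  show "bounded {d :: real^'n. (\<forall>i. 0 \<le> d $ i) \<and> (\<Sum>i\<in>UNIV. d $ i) \<le> R}"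
    unfolding bounded_iff
    \<comment> \<open>For nonnegative entries the sum is the l1 norm, which dominates the Euclidean
      norm.\<close>
    by (rule exI[of _ R]) (auto intro: order_trans[OF norm_le_l1_cart])
qed

lemma compact_psd_trace_le: "compact (psd_trace_le R)"
  unfolding psd_trace_le_eq_image
  by (intro compact_continuous_image continuous_on_unitary_conj compact_spectral_data)

text \<open>Only 0 is delicate: the value there is 0 because of the factor \<open>x\<close>, and it
  matches the limit from the right.\<close>

lemma continuous_on_x_ln_x: "continuous_on {0..} (\<lambda>x::real. x * ln x)"
  unfolding continuous_on_eq_continuous_within
proof
  fix x :: real assume "x \<in> {0..}"
  show "continuous (at x within {0..}) (\<lambda>x. x * ln x)"
  proof (cases "x = 0")
    case True
    have "((\<lambda>x::real. x * ln x) \<longlongrightarrow> 0) (at_right 0)"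
      by real_asymp
    then have "((\<lambda>x::real. x * ln x) \<longlongrightarrow> 0) (at 0 within {0..})"
      by (simp add: at_within_Ici_at_right)
    with True show ?thesis
      by (simp add: continuous_within)
  qed (auto intro!: continuous_intros)
qed

text \<open>
  The entropy is a continuous function of the spectral data \<open>(U, d)\<close>, which range over a compact
  set. So preimages of closed sets under the entropy are images of compact sets.
\<close>

lemma continuous_on_xlogx_trace:
  "continuous_on (psd_trace_le R :: (complex^'n^'n) set) xlogx_trace"
  unfolding continuous_on_closed_vimage[OF compact_imp_closed[OF compact_psd_trace_le]]
proof (intro allI impI)
  define D :: "((complex^'n^'n) \<times> (real^'n)) set" where "D = spectral_data R"
  define p :: "(complex^'n^'n) \<times> (real^'n) \<Rightarrow> complex^'n^'n" where "p = (\<lambda>(U, d). unitary_conj U d)"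
  define g :: "(complex^'n^'n) \<times> (real^'n) \<Rightarrow> real" where "g x = (\<Sum>i\<in>UNIV. snd x $ i * ln (snd x $ i))" for x
  fix B :: "real set" assume "closed B"
  have D: "compact D"
    unfolding D_def by (rule compact_spectral_data)
  have "continuous_on D g"
    unfolding g_def
    by (intro continuous_on_sum continuous_on_compose2[OF continuous_on_x_ln_x] continuous_intros)
       (auto simp: D_def spectral_data_def)
  then have "closed (D \<inter> g -` B)"
    by (intro continuous_closed_preimage compact_imp_closed D \<open>closed B\<close>)
  from compact_Int_closed[OF D this] have "compact (D \<inter> g -` B)"
    by simp
  then have "compact (p ` (D \<inter> g -` B))"
    unfolding p_def by (intro compact_continuous_image continuous_on_unitary_conj)
  \<comment> \<open>Although \<open>p\<close> is not injective, \<open>g\<close> factors through it,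
    so pushing the preimage under \<open>g\<close> forward gives exactly the preimage under
    \<open>xlogx_trace\<close>.\<close>
  moreover have "xlogx_trace (p x) = g x" if "x \<in> D" for x
    using that by (cases x) (simp add: D_def p_def g_def spectral_data_def xlogx_trace_unitary_conj)
  then have "p ` (D \<inter> g -` B) = xlogx_trace -` B \<inter> p ` D"
    by auto
  moreover have "p ` D = psd_trace_le R"
    unfolding p_def D_def by (rule psd_trace_le_eq_image[symmetric])
  ultimately have "compact (xlogx_trace -` B \<inter> (psd_trace_le R :: (complex^'n^'n) set))"
    by simp
  then show "closed (xlogx_trace -` B \<inter> (psd_trace_le R :: (complex^'n^'n) set))"
    by (rule compact_imp_closed)
qed

section \<open>Bounds in terms of the trace\<close>

text \<open>The left side is the tangent of the convex function \<open>x * ln x\<close> at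
  \<open>exp (M - 1)\<close>, where the slope is \<open>M\<close>. The proof is
  \<open>ln y \<le> y - 1\<close> at \<open>y = exp (M - 1) / x\<close>.\<close>

lemma x_ln_x_ge:
  fixes x M :: real
  assumes "0 \<le> x"
  shows "M * x - exp (M - 1) \<le> x * ln x"
proof (cases "x = 0")
  case False
  with assms have "x > 0" by simp
  then have "M - 1 - ln x = ln (exp (M - 1) / x)"
    by (simp add: ln_div)
  also have "\<dots> \<le> exp (M - 1) / x - 1"
    using \<open>x > 0\<close> by (intro ln_le_minus_one) simp
  finally have "x * (M - ln x) \<le> x * (exp (M - 1) / x)"
    using \<open>x > 0\<close> by (intro mult_left_mono) auto
  then show ?thesis
    using \<open>x > 0\<close> by (simp add: algebra_simps)
qed simp

text \<open>The tangent bound summed over the eigenvalues. The free slope \<open>M\<close> later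
  lets the entropy absorb any linear term.\<close>

lemma xlogx_trace_ge:
  fixes A :: "complex^'n^'n"
  assumes "A \<in> herm_psd"
  shows "M * Re (trace A) - CARD('n) * exp (M - 1) \<le> xlogx_trace A"
proof -
  obtain U d where U: "U \<in> unitary_matrices" and d: "\<And>i. 0 \<le> d $ i" and A: "A = unitary_conj U d"
    using herm_psd_spectral_theorem[OF assms] by blast
  have "(\<Sum>i\<in>UNIV. M * d $ i - exp (M - 1)) \<le> (\<Sum>i\<in>UNIV. d $ i * ln (d $ i))"
    by (intro sum_mono x_ln_x_ge d)
  then show ?thesis
    by (simp add: A xlogx_trace_unitary_conj trace_unitary_conj U sum_subtractf sum_distrib_left)
qed

text \<open>In the rank-one expansion the weights are nonnegative with sum the trace, and entries of
  \<open>U\<close> have modulus at most 1.\<close>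

lemma herm_psd_norm_nth_le:
  assumes "A \<in> herm_psd"
  shows "norm (A $ a $ b) \<le> Re (trace A)"
proof -
  obtain U d where U: "U \<in> unitary_matrices" and d: "\<And>i. 0 \<le> d $ i" and A: "A = unitary_conj U d"
    using herm_psd_spectral_theorem[OF assms] by blast
  have "norm (A $ a $ b) \<le> (\<Sum>i\<in>UNIV. d $ i * (norm (U $ a $ i) * norm (U $ b $ i)))"
    unfolding A unitary_conj_nth
    by (rule sum_norm_le) (simp add: norm_mult d)
  also have "\<dots> \<le> (\<Sum>i\<in>UNIV. d $ i * (1 * 1))"
    by (intro sum_mono mult_left_mono mult_mono norm_unitary_nth_le_1 U d) auto
  finally show ?thesis
    by (simp add: A trace_unitary_conj U)
qed

text \<open>Controls the linear terms of the objective, with \<open>L\<close> being the cost or the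
  logarithm of a reference marginal.\<close>

lemma herm_psd_trace_mult_le:
  fixes A L :: "complex^'n^'n"
  assumes "A \<in> herm_psd"
  shows "\<bar>Re (trace (A ** L))\<bar> \<le> (\<Sum>i\<in>UNIV. \<Sum>j\<in>UNIV. norm (L $ j $ i)) * Re (trace A)"
proof -
  have "\<bar>Re (trace (A ** L))\<bar> \<le> norm (trace (A ** L))"
    by (rule abs_Re_le_cmod)
  also have "\<dots> \<le> (\<Sum>i\<in>UNIV. \<Sum>j\<in>UNIV. norm (A $ i $ j) * norm (L $ j $ i))"
    unfolding trace_def matrix_matrix_mult_def
    by (auto intro!: sum_norm_le simp: norm_mult)
  also have "\<dots> \<le> (\<Sum>i\<in>UNIV. \<Sum>j\<in>UNIV. Re (trace A) * norm (L $ j $ i))"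
    by (intro sum_mono mult_right_mono herm_psd_norm_nth_le assms) auto
  finally show ?thesis
    by (simp add: sum_distrib_left[symmetric] mult.commute)
qed

section \<open>Partial traces\<close>

lemma continuous_on_ptrace_snd [continuous_intros]:
  "continuous_on S f \<Longrightarrow> continuous_on S (\<lambda>x. ptrace_snd (f x))"
  unfolding ptrace_snd_def by (intro continuous_intros)

lemma continuous_on_ptrace_fst [continuous_intros]:
  "continuous_on S f \<Longrightarrow> continuous_on S (\<lambda>x. ptrace_fst (f x))"
  unfolding ptrace_fst_def by (intro continuous_intros)

text \<open>With its counterpart below, lets a single trace bound control a matrix and both its
  marginals.\<close>

lemma trace_ptrace_snd: "trace (ptrace_snd G) = trace G"
  by (simp add: trace_def ptrace_snd_def sum.cartesian_product)

lemma trace_ptrace_fst: "trace (ptrace_fst G) = trace G"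
  unfolding trace_def ptrace_fst_def
  by (simp, subst sum.swap) (simp add: sum.cartesian_product)

text \<open>Extending \<open>v\<close> by zero off the range of \<open>e\<close> turns the form of
  the submatrix into that of \<open>A\<close>. Partial traces are sums of such submatrices, hence
  positive semi-definite.\<close>

lemma principal_submatrix_herm_psd:
  fixes A :: "complex^'n^'n" and e :: "'m::finite \<Rightarrow> 'n"
  assumes A: "A \<in> herm_psd" and e: "inj e"
  shows "(\<chi> i j. A $ e i $ e j) \<in> herm_psd" (is "?B \<in> _")
proof -
  have "hermitian ?B"
    using A by (simp add: herm_psd_def hermitian_nth) (simp add: hermitian_def cadjoint_def
        vec_eq_iff)
  moreover have "0 \<le> Re (cinner_vec v (?B *v v))" for v
  proof -
    define w where "w = (\<chi> x. if x \<in> range e then v $ inv e x else 0)"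
    \<comment> \<open>Stated for any summand vanishing at 0, so that it serves both the
      matrix-vector product and the inner product.\<close>
    have sum_w: "(\<Sum>x\<in>UNIV. h x (w $ x)) = (\<Sum>i\<in>UNIV. h (e i) (v $ i))"
      if "\<And>x. h x 0 = 0" for h :: "'n \<Rightarrow> complex \<Rightarrow> complex"
    proof -
      have "(\<Sum>x\<in>UNIV. h x (w $ x)) = (\<Sum>x\<in>range e. h x (w $ x))"
        by (rule sum.mono_neutral_right) (auto simp: w_def that)
      also have "\<dots> = (\<Sum>i\<in>UNIV. h (e i) (v $ i))"
        by (simp add: sum.reindex e) (simp add: w_def e)
      finally show ?thesis .
    qed
    have "(A *v w) $ e i = (?B *v v) $ i" for i
      using sum_w[of "\<lambda>x z. A $ e i $ x * z"] by (simp add: matrix_vector_mult_def)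
    then have "cinner_vec w (A *v w) = cinner_vec v (?B *v v)"
      using sum_w[of "\<lambda>x z. cnj z * (A *v w) $ x"] by (simp add: cinner_vec_def)
    moreover have "0 \<le> Re (cinner_vec w (A *v w))"
      using A by (simp add: herm_psd_def)
    ultimately show ?thesis by simp
  qed
  ultimately show ?thesis by (simp add: herm_psd_def)
qed

lemma zero_herm_psd: "0 \<in> herm_psd"
  by (simp add: herm_psd_def hermitian_def cadjoint_def cinner_vec_def vec_eq_iff)

lemma herm_psd_add:
  assumes "A \<in> herm_psd" "B \<in> herm_psd"
  shows "A + B \<in> herm_psd"
  using assms
  by (simp add: herm_psd_def matrix_vector_mult_add_rdistrib cinner_vec_add_right)
    (simp add: hermitian_def cadjoint_def vec_eq_iff)

lemma herm_psd_sum: "(\<And>i. i \<in> I \<Longrightarrow> A i \<in> herm_psd) \<Longrightarrow> sum A I \<in> herm_psd"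
  by (induction I rule: infinite_finite_induct) (simp_all add: zero_herm_psd herm_psd_add)

lemma ptrace_snd_herm_psd:
  assumes "G \<in> herm_psd"
  shows "ptrace_snd G \<in> herm_psd"
proof -
  have "(\<chi> i j. G $ (i, k) $ (j, k)) \<in> herm_psd" for k
    using principal_submatrix_herm_psd[OF assms, of "\<lambda>i. (i, k)"] by (simp add: inj_def)
  moreover have "ptrace_snd G = (\<Sum>k\<in>UNIV. \<chi> i j. G $ (i, k) $ (j, k))"
    by (simp add: ptrace_snd_def vec_eq_iff)
  ultimately show ?thesis
    by (simp add: herm_psd_sum)
qed

lemma ptrace_fst_herm_psd:
  assumes "G \<in> herm_psd"
  shows "ptrace_fst G \<in> herm_psd"
proof -
  have "(\<chi> k l. G $ (i, k) $ (i, l)) \<in> herm_psd" for i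
    using principal_submatrix_herm_psd[OF assms, of "\<lambda>k. (i, k)"] by (simp add: inj_def)
  moreover have "ptrace_fst G = (\<Sum>i\<in>UNIV. \<chi> k l. G $ (i, k) $ (i, l))"
    by (simp add: ptrace_fst_def vec_eq_iff)
  ultimately show ?thesis
    by (simp add: herm_psd_sum)
qed

lemma matrix_sub_ldistrib:
  fixes A :: "complex^'m^'n"
  shows "A ** (B - C) = A ** B - A ** C"
  by (simp add: matrix_matrix_mult_def vec_eq_iff right_diff_distrib sum_subtractf)

section \<open>Existence of a minimizer\<close>

lemma vn_entropy_eq: "vn_entropy G = xlogx_trace G - Re (trace G)"
  by (simp add: vn_entropy_def xlogx_trace_def matrix_sub_ldistrib trace_sub)

text \<open>For fixed \<open>B\<close>, \<open>mat_log B\<close> is a constant matrix even if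
  \<open>B\<close> is singular, so all terms but \<open>xlogx_trace A\<close> are affine in
  \<open>A\<close>.\<close>

lemma rel_entropy_eq:
  "mat_kernel B \<subseteq> mat_kernel A \<Longrightarrow>
    rel_entropy A B = ereal (xlogx_trace A - Re (trace (A ** mat_log B)) - Re (trace A) + Re (trace B))"
  by (simp add: rel_entropy_def xlogx_trace_def matrix_sub_ldistrib trace_sub trace_add)

theorem proposition3p2:
  fixes \<epsilon> \<tau>\<^sub>1 \<tau>\<^sub>2 :: real
    and C :: "complex^('m::finite \<times> 'n::finite)^('m \<times> 'n)"
    and \<rho> :: "complex^'m^'m"
    and \<sigma> :: "complex^'n^'n"
  assumes "\<epsilon> > 0" and "\<tau>\<^sub>1 > 0" and "\<tau>\<^sub>2 > 0"
    and "hermitian C"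
    and "\<rho> \<in> herm_psd" and "\<sigma> \<in> herm_psd"
  shows "\<exists>\<Gamma>\<in>herm_psd. unbalanced_qot C \<epsilon> \<tau>\<^sub>1 \<tau>\<^sub>2 \<rho> \<sigma> \<Gamma>
           = (INF G\<in>herm_psd. unbalanced_qot C \<epsilon> \<tau>\<^sub>1 \<tau>\<^sub>2 \<rho> \<sigma> G)"
proof -
  let ?F = "unbalanced_qot C \<epsilon> \<tau>\<^sub>1 \<tau>\<^sub>2 \<rho> \<sigma>"
  define K where "K = {G :: complex^('m \<times> 'n)^('m \<times> 'n).
    mat_kernel \<rho> \<subseteq> mat_kernel (ptrace_snd G) \<and> mat_kernel \<sigma> \<subseteq> mat_kernel (ptrace_fst G)}"
  \<comment> \<open>The finite branch of the objective, extended to all matrices so that continuity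
    and coercivity can be proved without the kernel conditions.\<close>
  define f where "f G = Re (trace (G ** C)) + \<epsilon> * (xlogx_trace G - Re (trace G))
      + \<tau>\<^sub>1 * (xlogx_trace (ptrace_snd G) - Re (trace (ptrace_snd G ** mat_log \<rho>)) - Re (trace G) + Re (trace \<rho>))
      + \<tau>\<^sub>2 * (xlogx_trace (ptrace_fst G) - Re (trace (ptrace_fst G ** mat_log \<sigma>)) - Re (trace G) + Re (trace \<sigma>))"
    for G
  have F_K: "?F G = ereal (f G)" if "G \<in> K" for G
    using that unfolding K_def
    by (auto simp: unbalanced_qot_def vn_entropy_eq rel_entropy_eq f_def trace_ptrace_snd
        trace_ptrace_fst trace_mult_commute[of C])
  \<comment> \<open>A violated kernel condition gives an infinite term with positive weight, and no
    other term is minus infinity.\<close>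
  have F_not_K: "?F G = \<infinity>" if "G \<notin> K" for G
    using that \<open>\<tau>\<^sub>1 > 0\<close> \<open>\<tau>\<^sub>2 > 0\<close>
    by (auto simp: K_def unbalanced_qot_def rel_entropy_def)
  \<comment> \<open>Both partial traces map \<open>psd_trace_le R\<close> into the set with the same
    bound \<open>R\<close>, so continuity of \<open>xlogx_trace\<close> composes.\<close>
  have cont: "continuous_on (psd_trace_le R) f" for R
  proof -
    have 1: "continuous_on (psd_trace_le R) (\<lambda>G :: complex^('m \<times> 'n)^('m \<times> 'n). xlogx_trace (ptrace_snd G))"
      by (rule continuous_on_compose2[OF continuous_on_xlogx_trace[of R]])
         (auto intro!: continuous_intros simp: psd_trace_le_def ptrace_snd_herm_psd trace_ptrace_snd)
    have 2: "continuous_on (psd_trace_le R) (\<lambda>G :: complex^('m \<times> 'n)^('m \<times> 'n). xlogx_trace (ptrace_fst G))"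
      by (rule continuous_on_compose2[OF continuous_on_xlogx_trace[of R]])
         (auto intro!: continuous_intros simp: psd_trace_le_def ptrace_fst_herm_psd trace_ptrace_fst)
    show ?thesis
      unfolding f_def by (intro continuous_intros 1 2 continuous_on_xlogx_trace)
  qed
  have "closed K"
  proof -
    \<comment> \<open>Each fixed \<open>v\<close> imposes a closed linear condition on
      \<open>G\<close>.\<close>
    have "K = (\<Inter>v\<in>mat_kernel \<rho>. {G. ptrace_snd G *v v = 0}) \<inter> (\<Inter>v\<in>mat_kernel \<sigma>. {G. ptrace_fst G *v v = 0})"
      by (auto simp: K_def mat_kernel_def)
    also have "closed \<dots>"
      unfolding matrix_vector_mult_def
      by (intro closed_Int closed_INT ballI closed_Collect_eq continuous_intros)
    finally show ?thesis .
  qed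
  have "0 \<in> K"
    by (auto simp: K_def mat_kernel_def ptrace_snd_def ptrace_fst_def matrix_vector_mult_def
        vec_eq_iff)
  obtain c where coercive: "\<And>G. G \<in> herm_psd \<Longrightarrow> Re (trace G) - c \<le> f G"
  proof -
    define cC where "cC = (\<Sum>i\<in>UNIV. \<Sum>j\<in>UNIV. norm (C $ j $ i))"
    define c1 where "c1 = (\<Sum>i\<in>UNIV. \<Sum>j\<in>UNIV. norm (mat_log \<rho> $ j $ i))"
    define c2 where "c2 = (\<Sum>i\<in>UNIV. \<Sum>j\<in>UNIV. norm (mat_log \<sigma> $ j $ i))"
    \<comment> \<open>Chosen so that \<open>\<epsilon> * M\<close> pays for the cost, both logarithm
      terms and all \<open>- Tr\<close> terms, leaving slope 1 in the trace.\<close>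
    define M where "M = (cC + \<epsilon> + \<tau>\<^sub>1 * (c1 + 1) + \<tau>\<^sub>2 * (c2 + 1) + 1) / \<epsilon>"
    \<comment> \<open>Collects the constants. The marginal entropies need no growth, so their
      tangent bound is taken at slope 0, which explains \<open>exp (0 - 1)\<close>.\<close>
    define c where "c = \<epsilon> * (CARD('m \<times> 'n) * exp (M - 1))
      + \<tau>\<^sub>1 * (CARD('m) * exp (0 - 1) - Re (trace \<rho>)) + \<tau>\<^sub>2 * (CARD('n) * exp (0 - 1) - Re (trace \<sigma>))"
    show ?thesis
    proof (rule that[of c])
      fix G :: "complex^('m \<times> 'n)^('m \<times> 'n)" assume G: "G \<in> herm_psd"
      let ?t = "Re (trace G)"
      note G1 = ptrace_snd_herm_psd[OF G] and G2 = ptrace_fst_herm_psd[OF G]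
      have "- (cC * ?t) \<le> Re (trace (G ** C))"
        using herm_psd_trace_mult_le[OF G, of C] by (simp add: cC_def)
      moreover have "\<epsilon> * (M * ?t - CARD('m \<times> 'n) * exp (M - 1) - ?t) \<le> \<epsilon> * (xlogx_trace G - ?t)"
        using xlogx_trace_ge[OF G, of M] \<open>\<epsilon> > 0\<close> by (intro mult_left_mono diff_right_mono) auto
      moreover have "\<tau>\<^sub>1 * (- (CARD('m) * exp (0 - 1)) - c1 * ?t - ?t + Re (trace \<rho>)) \<le>
          \<tau>\<^sub>1 * (xlogx_trace (ptrace_snd G) - Re (trace (ptrace_snd G ** mat_log \<rho>)) - ?t + Re (trace \<rho>))"
        using xlogx_trace_ge[OF G1, of 0] herm_psd_trace_mult_le[OF G1, of "mat_log \<rho>"] \<open>\<tau>\<^sub>1 > 0\<close>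
        by (intro mult_left_mono) (auto simp: c1_def trace_ptrace_snd)
      moreover have "\<tau>\<^sub>2 * (- (CARD('n) * exp (0 - 1)) - c2 * ?t - ?t + Re (trace \<sigma>)) \<le>
          \<tau>\<^sub>2 * (xlogx_trace (ptrace_fst G) - Re (trace (ptrace_fst G ** mat_log \<sigma>)) - ?t + Re (trace \<sigma>))"
        using xlogx_trace_ge[OF G2, of 0] herm_psd_trace_mult_le[OF G2, of "mat_log \<sigma>"] \<open>\<tau>\<^sub>2 > 0\<close>
        by (intro mult_left_mono) (auto simp: c2_def trace_ptrace_fst)
      moreover have "\<epsilon> * (M * ?t) = (cC + \<epsilon> + \<tau>\<^sub>1 * (c1 + 1) + \<tau>\<^sub>2 * (c2 + 1) + 1) * ?t"
        using \<open>\<epsilon> > 0\<close> by (simp add: M_def)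
      ultimately show "?t - c \<le> f G"
        unfolding f_def c_def by (simp only: ring_distribs)
    qed
  qed
  \<comment> \<open>Beyond trace \<open>f 0 + c\<close>, coercivity forces values above
    \<open>f 0\<close>. The same bound at the zero matrix gives \<open>0 \<le> f 0 + c\<close>, so
    \<open>0 \<in> S\<close>.\<close>
  define S where "S = psd_trace_le (f 0 + c) \<inter> K"
  have "0 \<in> S"
    using \<open>0 \<in> K\<close> coercive[OF zero_herm_psd] by (simp add: S_def psd_trace_le_def zero_herm_psd)
  moreover have "compact S"
    unfolding S_def by (intro compact_Int_closed compact_psd_trace_le \<open>closed K\<close>)
  moreover have "continuous_on S f"
    using cont continuous_on_subset unfolding S_def by blast
  ultimately obtain \<Gamma> where \<Gamma>: "\<Gamma> \<in> S" and min: "\<And>G. G \<in> S \<Longrightarrow> f \<Gamma> \<le> f G"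
    using continuous_attains_inf[of S f] by blast
  have "f \<Gamma> \<le> f G" if "G \<in> herm_psd" "G \<in> K" for G
  proof (cases "G \<in> S")
    case False
    then have "f 0 + c < Re (trace G)"
      using that by (auto simp: S_def psd_trace_le_def)
    then have "f 0 \<le> f G"
      using coercive[OF that(1)] by linarith
    with min[OF \<open>0 \<in> S\<close>] show ?thesis by linarith
  qed (rule min)
  then have "?F \<Gamma> \<le> ?F G" if "G \<in> herm_psd" for G
    using that F_K F_not_K \<Gamma> by (cases "G \<in> K") (auto simp: S_def)
  moreover have "\<Gamma> \<in> herm_psd"
    using \<Gamma> by (simp add: S_def psd_trace_le_def)
  ultimately show ?thesis
    by (intro bexI[of _ \<Gamma>] antisym INF_greatest INF_lower)
qed

end
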